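(* The polynomial $f(x)=p(x^2)+x\,q(x^2)$, with $p(x),q(x)\in\mathbb{R}[x]$, is stable if and only if $c:=p(0)/q(0)>0$ and the polynomial $\widetilde f(x)=\widetilde p(x^2)+x\,\widetilde q(x^2)$ is stable, where $$\widetilde p(x):=q(x),\qquad \widetilde q(x):=\frac{1}{x}\bigl(p(x)-c\,q(x)\bigr).$$
   Context: A polynomial $f$ is called stable if the condition $f(z)=0$ (for $z\in\mathbb{C}$) implies $\operatorname{Re} z<0$.
   Formalization: Nonzero constant polynomials f are excluded: for them q = 0, so c = p(0)/q(0) is undefined while f is vacuously stable, and the equivalence fails; when q(0) = 0 the condition c > 0 is read as false. *)

theory Defs
  imports Complex_Main "HOL-Computational_Algebra.Polynomial"
begin

definition stable :: "complex poly \<Rightarrow> bool" where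
  "stable f \<longleftrightarrow> (\<forall>z. poly f z = 0 \<longrightarrow> Re z < 0)"

abbreviation real_stable :: "real poly \<Rightarrow> bool" where
  "real_stable f \<equiv> stable (map_poly complex_of_real f)"

definition from_parts :: "'a::comm_semiring_1 poly \<Rightarrow> 'a poly \<Rightarrow> 'a poly" where
  "from_parts p q = pcompose p (monom 1 2) + monom 1 1 * pcompose q (monom 1 2)"

text \<open>
  Nonzero constants are vacuously stable, while the zero polynomial is not.
  A nonzero constant is \<open>from_parts p q\<close> with \<open>q = 0\<close>, so the quotient \<open>c = p(0)/q(0)\<close> of the
  theorem is undefined for it (\<open>c = 0\<close> under the convention \<open>x / 0 = 0\<close>) and the equivalence fails;
  the theorem therefore excludes exactly the nonzero constants.

  If \<open>q(0) \<noteq> 0\<close>, then \<open>p - c q\<close> vanishes at \<open>0\<close> and its division by \<open>x\<close> is exact. If \<open>q(0) = 0\<close>,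
  then \<open>c = 0\<close>, so the condition \<open>c > 0\<close> is false, as it should be when \<open>c\<close> is undefined.
\<close>

end

theory Submission
  imports Defs "HOL-Computational_Algebra.Fundamental_Theorem_Algebra"
begin

text \<open>
  Write \<open>E(z) = p(z\<^sup>2)\<close> and \<open>O(z) = z q(z\<^sup>2)\<close> for the even and the odd part of \<open>f\<close>. Stability is
  governed by the sign of the real part of \<open>E/O\<close>: all zeros of \<open>f\<close> lie in the left half plane, so a
  point \<open>z\<close> of the right half plane is at least as far from each zero as its mirror image is, whence
  \<open>\<bar>f(-z)\<bar> \<le> \<bar>f(z)\<bar>\<close>. As \<open>f(\<plusminus>z) = E(z) \<plusminus> O(z)\<close>, this says \<open>Re (E(z) cnj O(z)) \<ge> 0\<close>.
  The polynomial \<open>f'\<close> has even part \<open>O/z\<close> and odd part \<open>(E - c O/z)/z\<close>, so the quotient of its odd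
  by its even part is \<open>E/O - c/z\<close>: the pole of \<open>E/O\<close> at the origin has been removed.

  Adding the term \<open>c/z\<close>, whose real part is nonnegative in the right half plane, preserves
  nonnegativity of real parts. Thus stability of \<open>f'\<close> and \<open>c > 0\<close> imply stability of \<open>f\<close>.

  Removing the pole is the harder direction: one needs \<open>Re (E/O) \<ge> Re (c/z)\<close>, which is sharper
  than \<open>Re (E/O) \<ge> 0\<close>. In terms of \<open>B(z) = f(-z)/f(z)\<close>, a finite Blaschke product of the right
  half plane with \<open>B(0) = 1\<close>, it reads
  \<open>Re z \<bar>1 - B\<bar>\<^sup>2 \<le> a \<bar>z\<bar>\<^sup>2 (1 - \<bar>B\<bar>\<^sup>2)\<close> with \<open>a = 1/c = q(0)/p(0)\<close>, the
  logarithmic derivative of \<open>f\<close> at \<open>0\<close>: this is Julia's boundary form of the Schwarz lemma. For Blaschke products it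
  is elementary. A single factor gives equality, and the inequality is
  inherited by products, with the constants \<open>a\<close> adding up, by Cauchy's inequality (lemma
  \<open>julia_bound_mult\<close>). The fundamental theorem of algebra then gives it for every stable polynomial
  (lemma \<open>stable_julia_bound\<close>).
\<close>

section \<open>Julia's inequality for stable polynomials\<close>

text \<open>
  The reflection in the imaginary axis, for complex coefficients: \<open>F\<^sup>#(z) = cnj (F(-cnj z))\<close>. For real
  coefficients it is \<open>F(-z)\<close>. Unlike \<open>F(-z)\<close>, it pairs the zeros of \<open>F\<close> with their mirror images
  one at a time, so non-real zeros need not be grouped in conjugate pairs.
\<close>
definition reflect :: "complex poly \<Rightarrow> complex \<Rightarrow> complex" where
  "reflect F z = cnj (poly F (- cnj z))"

text \<open>
  With \<open>B = F\<^sup>#/F\<close>, the last inequality is Julia's; it is multiplied by \<open>\<bar>F\<bar>\<^sup>2\<close> so that no zero of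
  \<open>F\<close> has to be excluded. For \<open>F(0) = 1\<close> the coefficient of \<open>z\<close> is the logarithmic derivative at \<open>0\<close>.
\<close>
definition julia_bound :: "complex poly \<Rightarrow> bool" where
  "julia_bound F \<longleftrightarrow> 0 \<le> Re (coeff F 1) \<and>
     (\<forall>z. 0 \<le> Re z \<longrightarrow> cmod (reflect F z) \<le> cmod (poly F z) \<and>
        Re z * (cmod (poly F z - reflect F z))\<^sup>2
          \<le> Re (coeff F 1) * ((cmod z)\<^sup>2 * ((cmod (poly F z))\<^sup>2 - (cmod (reflect F z))\<^sup>2)))"

lemma weighted_cauchy:
  fixes a b A B r u v :: real
  assumes "0 \<le> a" "0 \<le> b" "0 \<le> A" "0 \<le> B" "0 \<le> r" "0 \<le> u" "0 \<le> v"
    and u: "r * u\<^sup>2 \<le> a * A" and v: "r * v\<^sup>2 \<le> b * B"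
  shows "r * (u + v)\<^sup>2 \<le> (a + b) * (A + B)"
proof -
  have "(2 * (r * u * v))\<^sup>2 = 4 * ((r * u\<^sup>2) * (r * v\<^sup>2))"
    by (simp add: power2_eq_square)
  also have "\<dots> \<le> 4 * ((a * A) * (b * B))"
    using mult_mono[OF u v] assms by simp
  also have "\<dots> = (a * B + b * A)\<^sup>2 - (a * B - b * A)\<^sup>2"
    by (simp add: power2_eq_square algebra_simps)
  also have "\<dots> \<le> (a * B + b * A)\<^sup>2"
    by simp
  finally have "2 * (r * u * v) \<le> a * B + b * A"
    by (rule power2_le_imp_le) (use assms in auto)
  moreover have "r * (u + v)\<^sup>2 = r * u\<^sup>2 + r * v\<^sup>2 + 2 * (r * u * v)"
    by (simp add: power2_eq_square algebra_simps)
  ultimately show ?thesis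
    using u v by (simp add: algebra_simps)
qed

text \<open>
  Both sides of Julia's inequality split along
  \<open>FG - F\<^sup>#G\<^sup># = (F - F\<^sup>#)G + F\<^sup>#(G - G\<^sup>#)\<close> and
  \<open>\<bar>FG\<bar>\<^sup>2 - \<bar>F\<^sup>#G\<^sup>#\<bar>\<^sup>2 = (\<bar>F\<bar>\<^sup>2 - \<bar>F\<^sup>#\<bar>\<^sup>2)\<bar>G\<bar>\<^sup>2 + \<bar>F\<^sup>#\<bar>\<^sup>2(\<bar>G\<bar>\<^sup>2 - \<bar>G\<^sup>#\<bar>\<^sup>2)\<close>,
  and the two summands recombine by Cauchy's inequality.
\<close>
lemma julia_bound_mult:
  assumes F: "julia_bound F" "coeff F 0 = 1" and G: "julia_bound G" "coeff G 0 = 1"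
  shows "julia_bound (F * G)"
proof -
  define a b where "a = Re (coeff F 1)" and "b = Re (coeff G 1)"
  have ab: "0 \<le> a" "0 \<le> b"
    using F G by (auto simp: julia_bound_def a_def b_def)
  have coeff: "Re (coeff (F * G) 1) = a + b"
    using F G by (simp add: coeff_mult a_def b_def)
  have "cmod (reflect (F * G) z) \<le> cmod (poly (F * G) z) \<and>
        Re z * (cmod (poly (F * G) z - reflect (F * G) z))\<^sup>2
          \<le> (a + b) * ((cmod z)\<^sup>2 * ((cmod (poly (F * G) z))\<^sup>2 - (cmod (reflect (F * G) z))\<^sup>2))"
    if z: "0 \<le> Re z" for z
  proof -
    define f f' g g' where "f = poly F z" "f' = reflect F z" "g = poly G z" "g' = reflect G z"
    note fg = this
    have refl: "reflect (F * G) z = f' * g'"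
      by (simp add: reflect_def fg)
    have f: "cmod f' \<le> cmod f"
      "Re z * (cmod (f - f'))\<^sup>2 \<le> a * ((cmod z)\<^sup>2 * ((cmod f)\<^sup>2 - (cmod f')\<^sup>2))"
      using F(1) z by (auto simp: julia_bound_def fg a_def)
    have g: "cmod g' \<le> cmod g"
      "Re z * (cmod (g - g'))\<^sup>2 \<le> b * ((cmod z)\<^sup>2 * ((cmod g)\<^sup>2 - (cmod g')\<^sup>2))"
      using G(1) z by (auto simp: julia_bound_def fg b_def)
    define A where "A = (cmod z)\<^sup>2 * ((cmod f)\<^sup>2 - (cmod f')\<^sup>2) * (cmod g)\<^sup>2"
    define B where "B = (cmod z)\<^sup>2 * ((cmod g)\<^sup>2 - (cmod g')\<^sup>2) * (cmod f')\<^sup>2"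
    define u where "u = cmod (f - f') * cmod g"
    define v where "v = cmod (g - g') * cmod f'"
    have "f * g - f' * g' = (f - f') * g + (g - g') * f'"
      by (simp add: algebra_simps)
    then have "cmod (f * g - f' * g') \<le> u + v"
      unfolding u_def v_def by (metis norm_mult norm_triangle_ineq)
    then have "Re z * (cmod (f * g - f' * g'))\<^sup>2 \<le> Re z * (u + v)\<^sup>2"
      using z by (intro mult_left_mono power_mono) auto
    also have "\<dots> \<le> (a + b) * (A + B)"
    proof (rule weighted_cauchy)
      show "0 \<le> A" "0 \<le> B"
        using f g by (auto simp: A_def B_def intro!: mult_nonneg_nonneg power_mono)
      show "Re z * u\<^sup>2 \<le> a * A"
        using mult_right_mono[OF f(2), of "(cmod g)\<^sup>2"]
        by (simp add: u_def A_def power_mult_distrib mult_ac)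
      show "Re z * v\<^sup>2 \<le> b * B"
        using mult_right_mono[OF g(2), of "(cmod f')\<^sup>2"]
        by (simp add: v_def B_def power_mult_distrib mult_ac)
    qed (use ab z in \<open>auto simp: u_def v_def\<close>)
    also have "A + B = (cmod z)\<^sup>2 * ((cmod (f * g))\<^sup>2 - (cmod (f' * g'))\<^sup>2)"
      by (simp add: A_def B_def norm_mult power_mult_distrib algebra_simps)
    finally show ?thesis
      using f g unfolding refl by (auto simp: fg norm_mult intro!: mult_mono)
  qed
  then show ?thesis
    using ab unfolding julia_bound_def coeff by simp
qed

text \<open>
  A single Blaschke factor, where Julia's inequality is an equality. Here \<open>s\<close> is the inverse of
  a zero, so that the constant term is \<open>1\<close>.
\<close>
lemma julia_bound_linear:
  assumes s: "Re s < 0"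
  shows "julia_bound [:1, -s:]"
proof -
  have diff: "(cmod (poly [:1, -s:] z))\<^sup>2 - (cmod (reflect [:1, -s:] z))\<^sup>2 = - 4 * Re s * Re z"
    and gap: "(cmod (poly [:1, -s:] z - reflect [:1, -s:] z))\<^sup>2 = 4 * (Re s)\<^sup>2 * (cmod z)\<^sup>2" for z
    unfolding reflect_def cmod_power2 by (simp_all add: power2_eq_square algebra_simps)
  have "cmod (reflect [:1, -s:] z) \<le> cmod (poly [:1, -s:] z)" if "0 \<le> Re z" for z
  proof -
    have "Re s * Re z \<le> 0"
      using s that by (intro mult_nonpos_nonneg) auto
    then have "(cmod (reflect [:1, -s:] z))\<^sup>2 \<le> (cmod (poly [:1, -s:] z))\<^sup>2"
      using diff[of z] by linarith
    then show ?thesis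
      by (rule power2_le_imp_le) simp
  qed
  then show ?thesis
    using s unfolding julia_bound_def diff gap by (auto simp: power2_eq_square)
qed

lemma Re_inverse_neg: "Re z < 0 \<Longrightarrow> Re (inverse z) < 0"
  by (simp add: divide_neg_pos sum_power2_gt_zero_iff)

lemma stable_julia_bound:
  assumes "stable F" "coeff F 0 = 1"
  shows "julia_bound F \<and> (degree F > 0 \<longrightarrow> 0 < Re (coeff F 1))"
  using assms
proof (induction "degree F" arbitrary: F rule: less_induct)
  case less
  show ?case
  proof (cases "degree F = 0")
    case True
    then obtain k where "F = [:k:]"
      by (elim degree_eq_zeroE)
    then show ?thesis
      using less.prems by (simp add: julia_bound_def reflect_def)
  next
    case False
    then obtain r where r: "poly F r = 0"
      using fundamental_theorem_of_algebra[of F] by (auto simp: constant_degree)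
    then have Re_r: "Re r < 0"
      using less.prems by (auto simp: stable_def)
    then have r0: "r \<noteq> 0" by auto
    define s where "s = inverse r"
    have s: "Re s < 0"
      unfolding s_def using Re_r by (rule Re_inverse_neg)
    obtain K where K: "F = [:- r, 1:] * K"
      using r by (auto simp: poly_eq_0_iff_dvd)
    define G where "G = smult (- r) K"
    have F: "F = [:1, - s:] * G"
      using r0 unfolding K G_def s_def
      by (simp add: smult_diff_right smult_add_right)
    have G0: "coeff G 0 = 1"
      using less.prems(2) by (simp add: F coeff_mult)
    then have "G \<noteq> 0" by auto
    then have "degree F = Suc (degree G)"
      unfolding F using r0 by (subst degree_mult_eq) (auto simp: s_def)
    moreover have "stable G"
      using less.prems(1) by (auto simp: stable_def F)
    ultimately have G: "julia_bound G"
      using less.hyps[of G] G0 by auto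
    have "Re (coeff F 1) = Re (coeff G 1) - Re s"
      using G0 by (simp add: F coeff_mult)
    moreover have "0 \<le> Re (coeff G 1)"
      using G by (simp add: julia_bound_def)
    ultimately have "0 < Re (coeff F 1)"
      using s by linarith
    then show ?thesis
      unfolding F using julia_bound_mult[OF julia_bound_linear[OF s] _ G G0] by simp
  qed
qed

section \<open>Even and odd parts of real polynomials\<close>

abbreviation complex_poly :: "real poly \<Rightarrow> complex poly" where
  "complex_poly \<equiv> map_poly complex_of_real"

lemma complex_poly_add: "complex_poly (p + q) = complex_poly p + complex_poly q"
  by (intro poly_eqI) (simp add: coeff_map_poly)

lemma complex_poly_smult: "complex_poly (smult c p) = smult (of_real c) (complex_poly p)"
  by (intro poly_eqI) (simp add: coeff_map_poly)

lemma poly_complex_poly_0: "poly (complex_poly p) 0 = of_real (poly p 0)"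
  by (simp add: poly_0_coeff_0 coeff_map_poly)

text \<open>Horner's rule alternates between the two parts.\<close>
lemma from_parts_pCons: "from_parts (pCons a p) q = pCons a (from_parts q p)"
  by (simp add: from_parts_def pcompose_pCons monom_Suc numeral_2_eq_2 one_pCons monom_0
      add.commute)

lemma poly_from_parts: "poly (from_parts p q) z = poly p (z\<^sup>2) + z * poly q (z\<^sup>2)"
  by (simp add: from_parts_def poly_pcompose poly_monom)

lemma complex_poly_square:
  "poly (complex_poly (pcompose p (monom 1 2))) z = poly (complex_poly p) (z\<^sup>2)"
  by (induction p)
     (simp_all add: pcompose_pCons monom_Suc numeral_2_eq_2 map_poly_pCons complex_poly_add monom_0)

lemma poly_complex_from_parts:
  "poly (complex_poly (from_parts p q)) z
     = poly (complex_poly p) (z\<^sup>2) + z * poly (complex_poly q) (z\<^sup>2)"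
  by (simp add: from_parts_def complex_poly_add complex_poly_square monom_Suc monom_0
      map_poly_pCons one_pCons)

lemma coeff_from_parts:
  "coeff (from_parts p q) 0 = poly p 0" "coeff (from_parts p q) 1 = poly q 0"
  by (cases p; cases q; simp add: from_parts_pCons)+

lemma reflect_complex_poly: "reflect (complex_poly f) z = poly (complex_poly f) (- z)"
  unfolding reflect_def by (subst poly_cnj_real) (auto simp: coeff_map_poly)

lemma norm_sum_diff_eq_Re_mult_cnj:
  "(cmod (x + y))\<^sup>2 - (cmod (x - y))\<^sup>2 = 4 * Re (x * cnj y)"
  unfolding cmod_power2 by (simp add: power2_eq_square algebra_simps)

text \<open>
  Julia's inequality for \<open>f/f(0)\<close>, in terms of the even part \<open>E\<close> and the odd part \<open>O\<close>. Divided by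
  \<open>\<bar>z O\<bar>\<^sup>2\<close> the last inequality says \<open>Re (1/z) \<le> (q(0)/p(0)) Re (E/O)\<close>: the pole of \<open>E/O\<close> at
  the origin can be removed without losing nonnegativity of the real part.
\<close>
lemma real_stable_parts:
  fixes p q :: "real poly" and z :: complex
  defines "E \<equiv> poly (complex_poly p) (z\<^sup>2)" and "O' \<equiv> z * poly (complex_poly q) (z\<^sup>2)"
  assumes stable: "real_stable (from_parts p q)"
  shows "poly p 0 \<noteq> 0"
    and "degree (from_parts p q) > 0 \<Longrightarrow> poly q 0 / poly p 0 > 0"
    and "0 \<le> Re z \<Longrightarrow> 0 \<le> Re (E * cnj O')"
    and "0 \<le> Re z \<Longrightarrow>
           Re z * (cmod O')\<^sup>2 \<le> poly q 0 / poly p 0 * ((cmod z)\<^sup>2 * Re (E * cnj O'))"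
proof -
  define f where "f = from_parts p q"
  have "poly (complex_poly f) 0 \<noteq> 0"
    using stable unfolding stable_def f_def by fastforce
  then show p0: "poly p 0 \<noteq> 0"
    by (simp add: f_def poly_complex_poly_0 poly_from_parts)
  define k where "k = inverse (poly p 0)"
  have k: "k \<noteq> 0" using p0 by (simp add: k_def)
  define F where "F = complex_poly (smult k f)"
  have "stable F"
    using stable k by (simp add: stable_def F_def complex_poly_smult f_def)
  moreover have "coeff F 0 = 1"
    using p0 coeff_from_parts(1)[of p q] by (simp add: F_def f_def coeff_map_poly k_def)
  ultimately have F: "julia_bound F" "degree F > 0 \<longrightarrow> 0 < Re (coeff F 1)"
    using stable_julia_bound by auto
  have "coeff F 1 = of_real (k * poly q 0)"
    unfolding F_def by (simp only: coeff_map_poly of_real_0 coeff_smult f_def coeff_from_parts)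
  then have coeff: "Re (coeff F 1) = poly q 0 / poly p 0"
    by (simp only: Re_complex_of_real k_def divide_inverse mult.commute)
  have "degree F = degree f"
    using k by (simp add: F_def degree_map_poly)
  then show "poly q 0 / poly p 0 > 0" if "degree (from_parts p q) > 0"
    using F(2) that unfolding coeff f_def by simp
  have Fz: "poly F z = of_real k * (E + O')" and rF: "reflect F z = of_real k * (E - O')"
    unfolding F_def reflect_complex_poly
    by (simp_all add: complex_poly_smult f_def poly_complex_from_parts E_def O'_def)
  have drop: "(cmod (of_real k * w))\<^sup>2 = k\<^sup>2 * (cmod w)\<^sup>2" for w
    by (simp add: norm_mult power_mult_distrib)
  have diff: "(cmod (poly F z))\<^sup>2 - (cmod (reflect F z))\<^sup>2 = k\<^sup>2 * (4 * Re (E * cnj O'))"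
    unfolding Fz rF drop right_diff_distrib[symmetric] norm_sum_diff_eq_Re_mult_cnj ..
  have "poly F z - reflect F z = of_real k * (2 * O')"
    unfolding Fz rF by (simp add: algebra_simps)
  then have gap: "(cmod (poly F z - reflect F z))\<^sup>2 = k\<^sup>2 * (4 * (cmod O')\<^sup>2)"
    by (simp add: norm_mult power_mult_distrib)
  have k2: "0 < k\<^sup>2" using k by simp
  {
    assume z: "0 \<le> Re z"
    have "cmod (reflect F z) \<le> cmod (poly F z)"
      using F(1) z by (simp add: julia_bound_def)
    then have "0 \<le> k\<^sup>2 * (4 * Re (E * cnj O'))"
      unfolding diff[symmetric] by (simp add: power_mono)
    then show "0 \<le> Re (E * cnj O')"
      using k2 by (simp add: zero_le_mult_iff del: complex_mult_cnj times_complex.sel)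
    define c where "c = poly q 0 / poly p 0"
    define R where "R = Re (E * cnj O')"
    have "Re z * (k\<^sup>2 * (4 * (cmod O')\<^sup>2)) \<le> c * ((cmod z)\<^sup>2 * (k\<^sup>2 * (4 * R)))"
      using F(1) z unfolding julia_bound_def c_def R_def coeff[symmetric] gap[symmetric]
        diff[symmetric] by blast
    then have "(4 * k\<^sup>2) * (Re z * (cmod O')\<^sup>2) \<le> (4 * k\<^sup>2) * (c * ((cmod z)\<^sup>2 * R))"
      by (simp add: mult_ac)
    then show "Re z * (cmod O')\<^sup>2 \<le> poly q 0 / poly p 0 * ((cmod z)\<^sup>2 * Re (E * cnj O'))"
      using k2 unfolding c_def[symmetric] R_def[symmetric] by (simp only: mult_le_cancel_left_pos)
  }
qed

section \<open>One step of Routh's reduction\<close>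

lemma stable_from_reduced:
  fixes p q q' :: "real poly" and c :: real
  assumes c: "0 < c" and q0: "poly q 0 \<noteq> 0"
    and p: "p = smult c q + monom 1 1 * q'"
    and stable: "real_stable (from_parts q q')"
  shows "real_stable (from_parts p q)"
  unfolding stable_def
proof (intro allI impI, rule ccontr)
  fix z
  assume root: "poly (complex_poly (from_parts p q)) z = 0" and "\<not> Re z < 0"
  then have z: "0 \<le> Re z" by simp
  define E where "E = poly (complex_poly q) (z\<^sup>2)"
  define O' where "O' = z * poly (complex_poly q') (z\<^sup>2)"
  have "poly (complex_poly p) (z\<^sup>2) = of_real c * E + z * O'"
    by (simp add: p complex_poly_add complex_poly_smult E_def O'_def power2_eq_square
        map_poly_pCons monom_Suc monom_0)
  then have sum: "of_real c * E + z * O' + z * E = 0"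
    using root by (simp add: poly_complex_from_parts E_def)
  have nz: "z \<noteq> 0"
    using sum c q0 by (auto simp: E_def O'_def poly_complex_poly_0)
  have nonneg: "0 \<le> Re (E * cnj O')"
    using real_stable_parts(3)[OF stable z] by (simp add: E_def O'_def)
  \<comment> \<open>The equation reads \<open>O'/E = - c/z - 1\<close>, whose right-hand side has negative real part.\<close>
  have "of_real ((cmod z)\<^sup>2) * (O' * cnj E)
      = - (of_real c * cnj z + of_real ((cmod z)\<^sup>2)) * of_real ((cmod E)\<^sup>2)"
    unfolding complex_norm_square using sum by algebra
  then have "Re (of_real ((cmod z)\<^sup>2) * (O' * cnj E))
      = Re (- (of_real c * cnj z + of_real ((cmod z)\<^sup>2)) * of_real ((cmod E)\<^sup>2))"
    by simp
  then have eq: "(cmod z)\<^sup>2 * Re (E * cnj O') = - (c * Re z + (cmod z)\<^sup>2) * (cmod E)\<^sup>2"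
    by (simp add: algebra_simps)
  have "E = 0"
  proof (rule ccontr)
    assume "E \<noteq> 0"
    moreover have "0 < c * Re z + (cmod z)\<^sup>2"
      using c z nz by (intro add_nonneg_pos) auto
    ultimately have "0 < (c * Re z + (cmod z)\<^sup>2) * (cmod E)\<^sup>2"
      by simp
    moreover have "0 \<le> (cmod z)\<^sup>2 * Re (E * cnj O')"
      using nonneg by (intro mult_nonneg_nonneg) auto
    ultimately show False
      unfolding eq by linarith
  qed
  then have "E + O' = 0"
    using sum nz by simp
  then have "poly (complex_poly (from_parts q q')) z = 0"
    by (simp add: poly_complex_from_parts E_def O'_def)
  then show False
    using stable z unfolding stable_def by fastforce
qed

text \<open>
  At a zero \<open>z\<close> of the reduced polynomial, \<open>p(z\<^sup>2)/(z q(z\<^sup>2)) = c/z - 1\<close>, unless both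
  parts of \<open>p(z\<^sup>2) + z q(z\<^sup>2)\<close> vanish there. In the right half plane Julia's inequality forbids
  this: the real part on the left is at least \<open>Re (c/z)\<close>.
\<close>
lemma reduced_stable:
  fixes p q q' :: "real poly" and c :: real
  assumes c: "0 < c" "c = poly p 0 / poly q 0"
    and p: "p = smult c q + monom 1 1 * q'"
    and stable: "real_stable (from_parts p q)"
  shows "real_stable (from_parts q q')"
  unfolding stable_def
proof (intro allI impI, rule ccontr)
  fix z
  assume "poly (complex_poly (from_parts q q')) z = 0" and "\<not> Re z < 0"
  then have z: "0 \<le> Re z" by simp
  define E where "E = poly (complex_poly q) (z\<^sup>2)"
  define O' where "O' = z * poly (complex_poly q') (z\<^sup>2)"
  have O': "O' = - E"
    using \<open>poly (complex_poly (from_parts q q')) z = 0\<close>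
    by (simp add: poly_complex_from_parts E_def O'_def add_eq_0_iff)
  have even: "poly (complex_poly p) (z\<^sup>2) = (of_real c - z) * E"
  proof -
    have "poly (complex_poly p) (z\<^sup>2) = of_real c * E + z * O'"
      by (simp add: p complex_poly_add complex_poly_smult E_def O'_def power2_eq_square
          map_poly_pCons monom_Suc monom_0)
    then show ?thesis by (simp add: O' algebra_simps)
  qed
  have "poly q 0 / poly p 0 = 1 / c"
    using c(2) by simp
  then have julia: "Re z * (cmod (z * E))\<^sup>2
      \<le> 1 / c * ((cmod z)\<^sup>2 * Re ((of_real c - z) * E * cnj (z * E)))"
    using real_stable_parts(4)[OF stable z] unfolding even by (simp add: E_def)
  have "(of_real c - z) * E * cnj (z * E)
      = (of_real c * cnj z - of_real ((cmod z)\<^sup>2)) * of_real ((cmod E)\<^sup>2)"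
    unfolding complex_norm_square by (simp add: algebra_simps)
  then have Re: "Re ((of_real c - z) * E * cnj (z * E)) = (c * Re z - (cmod z)\<^sup>2) * (cmod E)\<^sup>2"
    by simp
  have "((cmod z)\<^sup>2 * cmod E)\<^sup>2 \<le> 0"
    using julia c(1) unfolding Re
    by (simp add: norm_mult power_mult_distrib field_simps power2_eq_square)
  then have "z = 0 \<or> E = 0"
    by simp
  \<comment> \<open>At \<open>z = 0\<close> the odd part vanishes, and \<open>O' = - E\<close>.\<close>
  then have "E = 0"
    using O' by (auto simp: O'_def)
  then have "poly (complex_poly (from_parts p q)) z = 0"
    using even by (simp add: poly_complex_from_parts E_def)
  then show False
    using stable z unfolding stable_def by fastforce
qed

theorem theorem2:
  fixes p q f p' q' f' :: "real poly" and c :: real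
  assumes f: "f = from_parts p q"
    and nonconst: "degree f > 0 \<or> f = 0"
    and c: "c = poly p 0 / poly q 0"
    and p': "p' = q"
    and q': "q' = (p - smult c q) div monom 1 1"
    and f': "f' = from_parts p' q'"
  shows "real_stable f \<longleftrightarrow> c > 0 \<and> real_stable f'"
proof -
  have split: "p = smult c q + monom 1 1 * q'" if "c > 0"
  proof -
    have "poly (p - smult c q) 0 = 0"
      using c that by auto
    then have "[:- 0, 1:] dvd p - smult c q"
      by (simp only: poly_eq_0_iff_dvd)
    then have "monom 1 1 dvd p - smult c q"
      by (simp add: monom_Suc monom_0)
    then show ?thesis
      by (simp add: q')
  qed
  have "c > 0" if "real_stable f"
  proof -
    have "f \<noteq> 0"
    proof
      assume "f = 0"
      then have "Re 0 < 0"
        using that unfolding stable_def by (metis map_poly_0 poly_0)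
      then show False by simp
    qed
    then have "degree (from_parts p q) > 0"
      using nonconst f by simp
    then have "poly q 0 / poly p 0 > 0"
      using real_stable_parts(2) that f by blast
    then show ?thesis
      unfolding c by (auto simp: zero_less_divide_iff)
  qed
  moreover have "poly q 0 \<noteq> 0" if "c > 0"
    using c that by auto
  ultimately show ?thesis
    using split stable_from_reduced reduced_stable c unfolding f f' p' by blast
qed

end
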